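(* Let $x,y\in\mathbb{R}$ with $x<y$. Let $a_1,a_2,a_3,a_4\in(0,1)$ and $\alpha_1,\alpha_2,\alpha_3,\alpha_4\in[0,1]$ satisfy $a_1+a_2+a_3+a_4=1$ and $1=\alpha_1>\alpha_2>\alpha_3>\alpha_4=0$. Then the inequality $$\sum_{i=1}^4 a_i f(\alpha_i x+(1-\alpha_i)y)\geq \frac{1}{y-x}\int_x^y f(t)\,dt$$ is satisfied by all convex functions $f:[x,y]\to\mathbb{R}$ if and only if $$\sum_{i=1}^4 a_i(1-\alpha_i)=\frac12$$ and at least one of the following conditions is satisfied: (i) $a_1\geq 1-\alpha_2$ and $a_1+a_2\geq 1-\alpha_3$; (ii) $a_1+a_2\leq 1-\alpha_2$ and $a_1+a_2+a_3\leq 1-\alpha_3$; (iii) $1-\alpha_2\leq a_1$ and $1-\alpha_3\geq a_1+a_2+a_3$; (iv) $1-\alpha_2\leq a_1$, $1-\alpha_3\in(a_1+a_2,a_1+a_2+a_3)$ and $\alpha_3\leq 2a_4$; (v) $1-\alpha_2\geq a_1+a_2$, $a_1+a_2+a_3>1-\alpha_3$ and $\alpha_3\leq 2a_4$; (vi) $a_1<1-\alpha_2$, $a_1+a_2\geq 1-\alpha_3$ and $2a_1+\alpha_2\geq 1$; (vii) $a_1<1-\alpha_2$, $a_1+a_2>1-\alpha_2$, $a_1+a_2+a_3\leq 1-\alpha_3$ and $2a_1+\alpha_2\geq 1$; (viii) $1-\alpha_2\in(a_1,a_1+a_2)$, $1-\alpha_3\in(a_1+a_2,a_1+a_2+a_3)$,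 $2a_1+\alpha_2\geq 1$ and $2a_1(1-\alpha_3)+2a_2(\alpha_2-\alpha_3)\geq(1-\alpha_3)^2$.
   Context: All intervals $(p,q)$ are open intervals of real numbers. The numbers $a_i,\alpha_i$ and the endpoints $x<y$ are fixed, and the quantification "for all convex functions" is over all convex $f:[x,y]\to\mathbb{R}$. *)

theory Defs
  imports "HOL-Analysis.Analysis"
begin

end

theory Submission
  imports Defs
begin

text \<open>
  Write \<open>z\<^sub>1 < z\<^sub>2 < z\<^sub>3 < z\<^sub>4\<close> for the four nodes, so that \<open>z\<^sub>1 = x\<close> and \<open>z\<^sub>4 = y\<close>. On each of the
  three intervals between consecutive nodes a convex function lies below its chord, so replacing it
  by the piecewise linear interpolant at the nodes keeps it convex, leaves the left-hand side
  unchanged and can only increase the integral. Hence the interpolants are the extreme case, and the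
  question is one about finitely many values \<open>f z\<^sub>i\<close>: the integral of the interpolant is the
  trapezoidal rule, with weights \<open>w\<^sub>i\<close>, and one asks when \<open>\<Sum> c\<^sub>i f z\<^sub>i \<ge> 0\<close> for \<open>c\<^sub>i = a\<^sub>i - w\<^sub>i\<close>.

  Affine functions force \<open>\<Sum> c\<^sub>i = 0\<close> and \<open>\<Sum> c\<^sub>i z\<^sub>i = 0\<close>. Under these two constraints
  \<open>\<Sum> c\<^sub>i f z\<^sub>i\<close> is the combination of the two slope increments at \<open>z\<^sub>2\<close> and \<open>z\<^sub>3\<close> with coefficients
  \<open>c\<^sub>1 (z\<^sub>2 - z\<^sub>1)\<close> and \<open>c\<^sub>4 (z\<^sub>4 - z\<^sub>3)\<close> (lemma \<open>four_point_functional_nonneg\<close>). A convex function has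
  nonnegative slope increments, and a kink at a single node realises each of them separately. So the
  inequality holds for all convex functions exactly if \<open>c\<^sub>1 \<ge> 0\<close> and \<open>c\<^sub>4 \<ge> 0\<close> (lemma
  \<open>four_point_ge_integral_iff\<close>); in normalised coordinates, if \<open>1 - \<alpha>\<^sub>2 \<le> 2 a\<^sub>1\<close> and \<open>\<alpha>\<^sub>3 \<le> 2 a\<^sub>4\<close>.

  The eight listed conditions are the case distinction on how \<open>1 - \<alpha>\<^sub>2\<close> and \<open>1 - \<alpha>\<^sub>3\<close> lie relative
  to the partial sums of the weights; in each case they state those of the two inequalities that the
  position does not already imply (lemma \<open>end_weight_bounds_iff_cases\<close>).
\<close>

section \<open>Convex functions on a compact interval\<close>

text \<open>
  A convex function may jump at the end points, so continuity gives integrability only on the open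
  interval, with a bound that has to be supplied separately: the larger of the two end point values
  bounds \<open>f\<close> from above, and since \<open>f t + f (x + y - t)\<close> is at least twice the midpoint value, this
  also bounds \<open>f\<close> from below.
\<close>

lemma convex_on_Icc_integrable:
  fixes f :: "real \<Rightarrow> real"
  assumes "convex_on {x..y} f"
  shows "f integrable_on {x..y}"
proof (cases "x < y")
  case False
  then show ?thesis
    using integrable_on_refl[of f y] by (cases "x = y") (auto simp: integrable_on_empty)
next
  case True
  define M where "M = max (f x) (f y)"
  define m where "m = f ((x + y) / 2)"
  have upper: "f t \<le> M" if "t \<in> {x..y}" for t
    using convex_on_le_max[OF assms that] by (simp add: M_def)
  have lower: "2 * m - M \<le> f t" if t: "t \<in> {x..y}" for t
  proof -
    have r: "x + y - t \<in> {x..y}" using t by auto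
    have "m = f ((1 - 1/2) *\<^sub>R t + (1/2) *\<^sub>R (x + y - t))"
      unfolding m_def by (rule arg_cong[of _ _ f]) (simp add: field_simps)
    also have "\<dots> \<le> (1 - 1/2) * f t + (1/2) * f (x + y - t)"
      by (rule convex_onD[OF assms]) (use t r in auto)
    finally show ?thesis using upper[OF r] by simp
  qed
  have "continuous_on {x<..<y} f"
    by (rule convex_on_continuous) (auto intro: convex_on_subset[OF assms])
  then have "f \<in> borel_measurable (lebesgue_on {x<..<y})"
    by (rule continuous_imp_measurable_on_sets_lebesgue) auto
  moreover have "(\<lambda>_. \<bar>M\<bar> + \<bar>2 * m - M\<bar>) integrable_on {x<..<y}"
    by (simp add: integrable_on_open_interval_real Henstock_Kurzweil_Integration.integrable_const_ivl)
  moreover have "norm (f t) \<le> \<bar>M\<bar> + \<bar>2 * m - M\<bar>" if "t \<in> {x<..<y}" for t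
    using upper[of t] lower[of t] that by auto
  ultimately have "f integrable_on {x<..<y}"
    by (rule measurable_bounded_by_integrable_imp_integrable) auto
  then show ?thesis by (simp add: integrable_on_open_interval_real)
qed

text \<open>The right half of the Hermite--Hadamard inequality: integrate the chord, which lies above.\<close>

lemma convex_on_integral_le_trapezoid:
  fixes f :: "real \<Rightarrow> real"
  assumes "convex_on {p..q} f" and "p < q"
  shows "integral {p..q} f \<le> (q - p) * (f p + f q) / 2"
proof -
  define s where "s = (f q - f p) / (q - p)"
  define F where "F t = f p * t + s * (t - p)\<^sup>2 / 2" for t
  have "((\<lambda>t. s * (t - p) + f p) has_integral F q - F p) {p..q}"
    unfolding F_def using assms(2)
    by (intro fundamental_theorem_of_calculus)
       (auto intro!: derivative_eq_intros simp flip: has_real_derivative_iff_has_vector_derivative)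
  moreover have "F q - F p = (q - p) * (f p + f q) / 2"
  proof -
    have "s * (q - p) = f q - f p" using assms(2) by (simp add: s_def)
    then have "s * (q - p)\<^sup>2 = (f q - f p) * (q - p)"
      by (simp add: power2_eq_square flip: mult.assoc)
    then show ?thesis by (simp add: F_def algebra_simps add_divide_distrib)
  qed
  ultimately have chord: "((\<lambda>t. s * (t - p) + f p) has_integral (q - p) * (f p + f q) / 2) {p..q}"
    by simp
  have "f t \<le> s * (t - p) + f p" if "t \<in> {p..q}" for t
    using convex_onD_Icc'[OF assms(1) that] by (simp add: s_def)
  then show ?thesis
    by (rule has_integral_le[OF integrable_integral[OF convex_on_Icc_integrable[OF assms(1)]] chord])
qed

lemma convex_on_slope_mono:
  fixes f :: "real \<Rightarrow> real"
  assumes "convex_on S f" and "p \<in> S" "r \<in> S" and "p < q" "q < r"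
  shows "(f q - f p) / (q - p) \<le> (f r - f q) / (r - q)"
proof -
  have "(f p - f q) / (p - q) \<le> (f q - f r) / (q - r)"
    using convex_on_slope_le[OF assms(1-3), of q] assms(4,5) by simp
  then show ?thesis
    using minus_divide_divide[of "f p - f q" "p - q"] minus_divide_divide[of "f q - f r" "q - r"]
    by simp
qed

section \<open>Integrals of functions with a single kink\<close>

lemma convex_on_max:
  assumes f: "convex_on S f" and g: "convex_on S g"
  shows "convex_on S (\<lambda>t. max (f t) (g t))"
proof (rule convex_onI)
  fix t :: real and u v
  assume t: "0 < t" "t < 1" and uv: "u \<in> S" "v \<in> S"
  let ?R = "(1 - t) * max (f u) (g u) + t * max (f v) (g v)"
  have "(1 - t) * f u + t * f v \<le> ?R" "(1 - t) * g u + t * g v \<le> ?R"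
    using t by (auto intro!: add_mono mult_left_mono)
  moreover have "f ((1 - t) *\<^sub>R u + t *\<^sub>R v) \<le> (1 - t) * f u + t * f v"
    "g ((1 - t) *\<^sub>R u + t *\<^sub>R v) \<le> (1 - t) * g u + t * g v"
    using convex_onD[OF f _ _ uv] convex_onD[OF g _ _ uv] t by simp_all
  ultimately show "max (f ((1 - t) *\<^sub>R u + t *\<^sub>R v)) (g ((1 - t) *\<^sub>R u + t *\<^sub>R v)) \<le> ?R"
    by linarith
qed (rule convex_on_imp_convex[OF f])

lemma convex_on_affine:
  fixes c d :: real
  assumes "convex S"
  shows "convex_on S (\<lambda>t. c * t + d)"
  by (rule convex_onI[OF _ assms]) (simp add: algebra_simps)

lemma convex_on_hinge_left:
  fixes z :: real
  assumes "convex S"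
  shows "convex_on S (\<lambda>t. max 0 (z - t))"
  using convex_on_max[OF convex_on_affine[OF assms, of 0 0] convex_on_affine[OF assms, of "-1" z]]
  by simp

lemma convex_on_hinge_right:
  fixes z :: real
  assumes "convex S"
  shows "convex_on S (\<lambda>t. max 0 (t - z))"
  using convex_on_max[OF convex_on_affine[OF assms, of 0 0] convex_on_affine[OF assms, of 1 "- z"]]
  by simp

lemma has_integral_hinge_left:
  fixes x y z :: real
  assumes "x \<le> z" "z \<le> y"
  shows "((\<lambda>t. max 0 (z - t)) has_integral (z - x)\<^sup>2 / 2) {x..y}"
proof -
  have "((\<lambda>t. z - t) has_integral (z * z - z\<^sup>2 / 2) - (z * x - x\<^sup>2 / 2)) {x..z}"
    using assms by (intro fundamental_theorem_of_calculus)
       (auto intro!: derivative_eq_intros simp flip: has_real_derivative_iff_has_vector_derivative)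
  also have "(z * z - z\<^sup>2 / 2) - (z * x - x\<^sup>2 / 2) = (z - x)\<^sup>2 / 2"
    by (simp add: power2_eq_square field_simps)
  finally have "((\<lambda>t. z - t) has_integral (z - x)\<^sup>2 / 2) {x..z}" .
  then have "((\<lambda>t. max 0 (z - t)) has_integral (z - x)\<^sup>2 / 2) {x..z}"
    by (subst has_integral_cong[where g = "\<lambda>t. z - t"]) auto
  moreover have "((\<lambda>t. max 0 (z - t)) has_integral 0) {z..y}"
    by (subst has_integral_cong[where g = "\<lambda>t. 0"]) auto
  ultimately have "((\<lambda>t. max 0 (z - t)) has_integral (z - x)\<^sup>2 / 2 + 0) {x..y}"
    by (rule has_integral_combine[OF assms])
  then show ?thesis by simp
qed

lemma has_integral_hinge_right:
  fixes x y z :: real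
  assumes "x \<le> z" "z \<le> y"
  shows "((\<lambda>t. max 0 (t - z)) has_integral (y - z)\<^sup>2 / 2) {x..y}"
proof -
  have "((\<lambda>t. max 0 (- z - t)) has_integral (y - z)\<^sup>2 / 2) {- y..- x}"
    using has_integral_hinge_left[of "- y" "- z" "- x"] assms by simp
  then show ?thesis
    using has_integral_reflect_real[where f = "\<lambda>t. max 0 (- z - t)" and a = "- y" and b = "- x"]
    by simp
qed

section \<open>The criterion for four nodes\<close>

text \<open>
  Abel summation: if \<open>c\<close> annihilates affine functions, the sum equals \<open>c1 (z2 - z1)\<close> times the slope
  increment at \<open>z2\<close> plus \<open>c4 (z4 - z3)\<close> times the slope increment at \<open>z3\<close>.
\<close>

lemma four_point_functional_nonneg:
  fixes f :: "real \<Rightarrow> real"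
  assumes f: "convex_on {z1..z4} f" and z: "z1 < z2" "z2 < z3" "z3 < z4"
    and c0: "c1 + c2 + c3 + c4 = 0" and c1: "c1 * z1 + c2 * z2 + c3 * z3 + c4 * z4 = 0"
    and nonneg: "c1 \<ge> 0" "c4 \<ge> 0"
  shows "c1 * f z1 + c2 * f z2 + c3 * f z3 + c4 * f z4 \<ge> 0"
proof -
  define s1 where "s1 = (f z2 - f z1) / (z2 - z1)"
  define s2 where "s2 = (f z3 - f z2) / (z3 - z2)"
  define s3 where "s3 = (f z4 - f z3) / (z4 - z3)"
  have s: "s1 \<le> s2" "s2 \<le> s3"
    unfolding s1_def s2_def s3_def using z by (auto intro!: convex_on_slope_mono[OF f])
  have v: "f z2 = f z1 + s1 * (z2 - z1)" "f z3 = f z2 + s2 * (z3 - z2)" "f z4 = f z3 + s3 * (z4 - z3)"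
    using z by (simp_all add: s1_def s2_def s3_def)
  have m: "c1 * (z2 - z1) + (c1 + c2) * (z3 - z2) = c4 * (z4 - z3)"
    using c0 c1 by algebra
  have "c1 * f z1 + c2 * f z2 + c3 * f z3 + c4 * f z4
      = c1 * (z2 - z1) * (s2 - s1) + c4 * (z4 - z3) * (s3 - s2)"
    using c0 m v by algebra
  also have "\<dots> \<ge> 0"
    using s z nonneg by simp
  finally show ?thesis .
qed

text \<open>
  The two inequalities on the right say that the outer weights dominate those of the composite
  trapezoidal rule.
\<close>

lemma four_point_ge_integral_iff:
  fixes a1 a2 a3 a4 :: real
  assumes z: "z1 < z2" "z2 < z3" "z3 < z4"
  shows "(\<forall>f. convex_on {z1..z4} f \<longrightarrow>
            integral {z1..z4} f \<le> (z4 - z1) * (a1 * f z1 + a2 * f z2 + a3 * f z3 + a4 * f z4)) \<longleftrightarrow>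
         a1 + a2 + a3 + a4 = 1 \<and> a1 * z1 + a2 * z2 + a3 * z3 + a4 * z4 = (z1 + z4) / 2 \<and>
         z2 - z1 \<le> 2 * a1 * (z4 - z1) \<and> z4 - z3 \<le> 2 * a4 * (z4 - z1)"
    (is "(\<forall>f. _ \<longrightarrow> ?P f) \<longleftrightarrow> ?mass \<and> ?mean \<and> ?left \<and> ?right")
proof
  assume *: "\<forall>f. convex_on {z1..z4} f \<longrightarrow> ?P f"
  have test: "I \<le> (z4 - z1) * (a1 * f z1 + a2 * f z2 + a3 * f z3 + a4 * f z4)"
    if "convex_on {z1..z4} f" "(f has_integral I) {z1..z4}" for f I
    using * that by (metis integral_unique)
  have pos: "z4 - z1 > 0" using z by simp
  have const: "((\<lambda>t. c) has_integral (z4 - z1) * c) {z1..z4}" for c :: real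
    using has_integral_const_real[of c z1 z4] pos by simp
  have "(z4 - z1) * c \<le> (z4 - z1) * (c * (a1 + a2 + a3 + a4))" for c
    using test[OF _ const[of c]] by (simp add: convex_on_const algebra_simps)
  then have "c \<le> c * (a1 + a2 + a3 + a4)" for c
    using pos by (simp add: mult_le_cancel_left_pos)
  from this[of 1] this[of "-1"] have mass: ?mass
    using pos by simp
  have linear: "((\<lambda>t. c * t) has_integral (z4 - z1) * (c * ((z1 + z4) / 2))) {z1..z4}" for c
  proof -
    have "((\<lambda>t. c * t) has_integral c * z4\<^sup>2 / 2 - c * z1\<^sup>2 / 2) {z1..z4}"
      using pos by (intro fundamental_theorem_of_calculus)
        (auto intro!: derivative_eq_intros simp flip: has_real_derivative_iff_has_vector_derivative)
    moreover have "c * z4\<^sup>2 / 2 - c * z1\<^sup>2 / 2 = (z4 - z1) * (c * ((z1 + z4) / 2))"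
      by (simp add: power2_eq_square field_simps)
    ultimately show ?thesis by simp
  qed
  have "convex_on {z1..z4} (\<lambda>t. c * t)" for c :: real
    using convex_on_affine[of "{z1..z4}" c 0] by simp
  then have "(z4 - z1) * (c * ((z1 + z4) / 2))
      \<le> (z4 - z1) * (a1 * (c * z1) + a2 * (c * z2) + a3 * (c * z3) + a4 * (c * z4))" for c
    using test[OF _ linear[of c]] by simp
  from this[of 1] this[of "-1"] have mean: ?mean
    using pos by (simp add: mult_le_cancel_left_pos)
  have "(z2 - z1)\<^sup>2 / 2 \<le> (z4 - z1) * (a1 * (z2 - z1))"
    using test[OF convex_on_hinge_left has_integral_hinge_left[of z1 z2 z4]] z by simp
  then have "(z2 - z1) * (z2 - z1) \<le> (z2 - z1) * (2 * a1 * (z4 - z1))"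
    by (simp add: power2_eq_square mult_ac)
  then have left: ?left
    using z by (simp add: mult_le_cancel_left_pos)
  have "(z4 - z3)\<^sup>2 / 2 \<le> (z4 - z1) * (a4 * (z4 - z3))"
    using test[OF convex_on_hinge_right has_integral_hinge_right[of z1 z3 z4]] z by simp
  moreover have "(z4 - z1) * (a4 * (z4 - z3)) = (z4 - z3) * (2 * a4 * (z4 - z1)) / 2"
    by simp
  ultimately have "(z4 - z3) * (z4 - z3) \<le> (z4 - z3) * (2 * a4 * (z4 - z1))"
    unfolding power2_eq_square by linarith
  then have right: ?right
    using z by (simp add: mult_le_cancel_left_pos)
  show "?mass \<and> ?mean \<and> ?left \<and> ?right"
    using mass mean left right by blast
next
  assume *: "?mass \<and> ?mean \<and> ?left \<and> ?right"
  show "\<forall>f. convex_on {z1..z4} f \<longrightarrow> ?P f"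
  proof (intro allI impI)
    fix f assume f: "convex_on {z1..z4} f"
    note int = convex_on_Icc_integrable[OF f]
    have trapezoid: "integral {p..q} f \<le> (q - p) * (f p + f q) / 2"
      if "z1 \<le> p" "p < q" "q \<le> z4" for p q
      using that by (intro convex_on_integral_le_trapezoid convex_on_subset[OF f]) auto
    have "integral {z1..z4} f = integral {z1..z2} f + integral {z2..z4} f"
      using z by (intro Henstock_Kurzweil_Integration.integral_combine[symmetric] int) auto
    also have "integral {z2..z4} f = integral {z2..z3} f + integral {z3..z4} f"
      using z by (intro Henstock_Kurzweil_Integration.integral_combine[symmetric]
          integrable_on_subinterval[OF int]) auto
    finally have "integral {z1..z4} f \<le> (z2 - z1) * (f z1 + f z2) / 2
        + (z3 - z2) * (f z2 + f z3) / 2 + (z4 - z3) * (f z3 + f z4) / 2"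
      using trapezoid[of z1 z2] trapezoid[of z2 z3] trapezoid[of z3 z4] z by linarith
    moreover
    (* twice (z4 - z1) times the excess of the weights over those of the trapezoidal rule *)
    define c1 where "c1 = 2 * a1 * (z4 - z1) - (z2 - z1)"
    define c2 where "c2 = 2 * a2 * (z4 - z1) - (z3 - z1)"
    define c3 where "c3 = 2 * a3 * (z4 - z1) - (z4 - z2)"
    define c4 where "c4 = 2 * a4 * (z4 - z1) - (z4 - z3)"
    have "c1 * f z1 + c2 * f z2 + c3 * f z3 + c4 * f z4 \<ge> 0"
    proof (rule four_point_functional_nonneg[OF f z])
      have "c1 + c2 + c3 + c4 = 2 * (z4 - z1) * (a1 + a2 + a3 + a4 - 1)"
        by (simp add: c1_def c2_def c3_def c4_def algebra_simps)
      then show "c1 + c2 + c3 + c4 = 0" using * by simp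
      have "c1 * z1 + c2 * z2 + c3 * z3 + c4 * z4
          = 2 * (z4 - z1) * (a1 * z1 + a2 * z2 + a3 * z3 + a4 * z4 - (z1 + z4) / 2)"
        by (simp add: c1_def c2_def c3_def c4_def field_simps)
      then show "c1 * z1 + c2 * z2 + c3 * z3 + c4 * z4 = 0" using * by simp
    qed (use * in \<open>auto simp: c1_def c4_def\<close>)
    ultimately show "?P f"
      by (simp add: c1_def c2_def c3_def c4_def field_simps)
  qed
qed

section \<open>The case distinction\<close>

text \<open>
  Let \<open>F\<close> be the distribution function of the weights \<open>a1, \<dots>, a4\<close> at \<open>0, b2, b3, 1\<close>, with
  \<open>b2 = 1 - \<alpha>2\<close> and \<open>b3 = 1 - \<alpha>3\<close>, and let \<open>H t\<close> be the integral of \<open>F s - s\<close> over \<open>s\<close> from \<open>0\<close> to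
  \<open>t\<close>. The two inequalities on the left say \<open>H b2 \<ge> 0\<close> and \<open>H b3 \<ge> 0\<close>. As the mean is \<open>1/2\<close>,
  \<open>H\<close> vanishes at \<open>1\<close> as well as at \<open>0\<close>, so \<open>H b3\<close> can be evaluated from either side; the last
  condition of the list uses the form obtained from \<open>0\<close>. In the remaining cases \<open>H\<close> is monotone on
  some of the intervals between nodes, which makes one inequality, or both, follow.
\<close>

lemma end_weight_bounds_iff_cases:
  fixes a1 a2 a3 a4 \<alpha>2 \<alpha>3 :: real
  assumes mass: "a1 + a2 + a3 + a4 = 1" and \<alpha>: "1 > \<alpha>2" "\<alpha>2 > \<alpha>3" "\<alpha>3 > 0"
    and a: "a1 > 0" "a4 > 0"
    and mean: "a2 * (1 - \<alpha>2) + a3 * (1 - \<alpha>3) + a4 = 1 / 2"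
  shows "2 * a1 + \<alpha>2 \<ge> 1 \<and> \<alpha>3 \<le> 2 * a4 \<longleftrightarrow>
      ((a1 \<ge> 1 - \<alpha>2 \<and> a1 + a2 \<ge> 1 - \<alpha>3) \<or>
       (a1 + a2 \<le> 1 - \<alpha>2 \<and> a1 + a2 + a3 \<le> 1 - \<alpha>3) \<or>
       (1 - \<alpha>2 \<le> a1 \<and> 1 - \<alpha>3 \<ge> a1 + a2 + a3) \<or>
       (1 - \<alpha>2 \<le> a1 \<and> 1 - \<alpha>3 \<in> {a1 + a2 <..< a1 + a2 + a3} \<and> \<alpha>3 \<le> 2 * a4) \<or>
       (1 - \<alpha>2 \<ge> a1 + a2 \<and> a1 + a2 + a3 > 1 - \<alpha>3 \<and> \<alpha>3 \<le> 2 * a4) \<or>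
       (a1 < 1 - \<alpha>2 \<and> a1 + a2 \<ge> 1 - \<alpha>3 \<and> 2 * a1 + \<alpha>2 \<ge> 1) \<or>
       (a1 < 1 - \<alpha>2 \<and> a1 + a2 > 1 - \<alpha>2 \<and> a1 + a2 + a3 \<le> 1 - \<alpha>3 \<and> 2 * a1 + \<alpha>2 \<ge> 1) \<or>
       (1 - \<alpha>2 \<in> {a1 <..< a1 + a2} \<and> 1 - \<alpha>3 \<in> {a1 + a2 <..< a1 + a2 + a3} \<and>
          2 * a1 + \<alpha>2 \<ge> 1 \<and> 2 * a1 * (1 - \<alpha>3) + 2 * a2 * (\<alpha>2 - \<alpha>3) \<ge> (1 - \<alpha>3)\<^sup>2))"
    (is "?L \<and> ?R \<longleftrightarrow> ?cases")
proof -
  have H3: "2 * a1 * (1 - \<alpha>3) + 2 * a2 * (\<alpha>2 - \<alpha>3) - (1 - \<alpha>3)\<^sup>2 = \<alpha>3 * (2 * a4 - \<alpha>3)"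
    using mass mean by algebra
  have R_iff: "2 * a1 * (1 - \<alpha>3) + 2 * a2 * (\<alpha>2 - \<alpha>3) \<ge> (1 - \<alpha>3)\<^sup>2 \<longleftrightarrow> ?R"
  proof -
    have "2 * a1 * (1 - \<alpha>3) + 2 * a2 * (\<alpha>2 - \<alpha>3) \<ge> (1 - \<alpha>3)\<^sup>2 \<longleftrightarrow> 0 \<le> \<alpha>3 * (2 * a4 - \<alpha>3)"
      using H3 by linarith
    also have "\<dots> \<longleftrightarrow> ?R" using \<alpha> by (simp add: zero_le_mult_iff)
    finally show ?thesis .
  qed
  (* twice the increment of H over the interval [b2, b3] *)
  have H23: "\<alpha>3 * (2 * a4 - \<alpha>3) - (1 - \<alpha>2) * (2 * a1 + \<alpha>2 - 1)
      = (\<alpha>2 - \<alpha>3) * (2 * (a1 + a2) - (1 - \<alpha>2) - (1 - \<alpha>3))"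
    unfolding H3[symmetric] by (simp add: power2_eq_square algebra_simps)
  have L_imp_R: ?R if ?L "1 - \<alpha>3 \<le> a1 + a2"
  proof -
    have "(1 - \<alpha>2) * (2 * a1 + \<alpha>2 - 1) \<ge> 0"
      "(\<alpha>2 - \<alpha>3) * (2 * (a1 + a2) - (1 - \<alpha>2) - (1 - \<alpha>3)) \<ge> 0"
      using that \<alpha> by simp_all
    then have "0 \<le> \<alpha>3 * (2 * a4 - \<alpha>3)" using H23 by linarith
    then show ?thesis using \<alpha> by (simp add: zero_le_mult_iff)
  qed
  have R_imp_L: ?L if ?R "a1 + a2 \<le> 1 - \<alpha>2"
  proof -
    have "0 \<le> \<alpha>3 * (2 * a4 - \<alpha>3)"
      "(\<alpha>2 - \<alpha>3) * (2 * (a1 + a2) - (1 - \<alpha>2) - (1 - \<alpha>3)) \<le> 0"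
      using that \<alpha> by (simp_all add: mult_le_0_iff)
    then have "0 \<le> (1 - \<alpha>2) * (2 * a1 + \<alpha>2 - 1)" using H23 by linarith
    then show ?thesis using \<alpha> by (simp add: zero_le_mult_iff)
  qed
  have L: ?L if "1 - \<alpha>2 \<le> a1" using that a by simp
  have R: ?R if "a1 + a2 + a3 \<le> 1 - \<alpha>3" using that a mass by simp
  show ?thesis
    unfolding R_iff greaterThanLessThan_iff
    using L R L_imp_R R_imp_L \<alpha> by argo
qed

section \<open>The characterisation\<close>

theorem theorem3:
  fixes x y :: real and a \<alpha> :: "nat \<Rightarrow> real"
  assumes "x < y"
    and "\<forall>i\<in>{1..4}. a i \<in> {0<..<1}"
    and "\<forall>i\<in>{1..4}. \<alpha> i \<in> {0..1}"
    and "a 1 + a 2 + a 3 + a 4 = 1"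
    and "1 = \<alpha> 1" and "\<alpha> 1 > \<alpha> 2" and "\<alpha> 2 > \<alpha> 3" and "\<alpha> 3 > \<alpha> 4" and "\<alpha> 4 = 0"
  shows "(\<forall>f :: real \<Rightarrow> real. convex_on {x..y} f \<longrightarrow>
            (\<Sum>i=1..4. a i * f (\<alpha> i * x + (1 - \<alpha> i) * y)) \<ge> 1 / (y - x) * integral {x..y} f)
    \<longleftrightarrow>
      (\<Sum>i=1..4. a i * (1 - \<alpha> i)) = 1 / 2 \<and>
      ((a 1 \<ge> 1 - \<alpha> 2 \<and> a 1 + a 2 \<ge> 1 - \<alpha> 3) \<or>
       (a 1 + a 2 \<le> 1 - \<alpha> 2 \<and> a 1 + a 2 + a 3 \<le> 1 - \<alpha> 3) \<or>
       (1 - \<alpha> 2 \<le> a 1 \<and> 1 - \<alpha> 3 \<ge> a 1 + a 2 + a 3) \<or>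
       (1 - \<alpha> 2 \<le> a 1 \<and> 1 - \<alpha> 3 \<in> {a 1 + a 2 <..< a 1 + a 2 + a 3} \<and> \<alpha> 3 \<le> 2 * a 4) \<or>
       (1 - \<alpha> 2 \<ge> a 1 + a 2 \<and> a 1 + a 2 + a 3 > 1 - \<alpha> 3 \<and> \<alpha> 3 \<le> 2 * a 4) \<or>
       (a 1 < 1 - \<alpha> 2 \<and> a 1 + a 2 \<ge> 1 - \<alpha> 3 \<and> 2 * a 1 + \<alpha> 2 \<ge> 1) \<or>
       (a 1 < 1 - \<alpha> 2 \<and> a 1 + a 2 > 1 - \<alpha> 2 \<and> a 1 + a 2 + a 3 \<le> 1 - \<alpha> 3 \<and>
          2 * a 1 + \<alpha> 2 \<ge> 1) \<or>
       (1 - \<alpha> 2 \<in> {a 1 <..< a 1 + a 2} \<and> 1 - \<alpha> 3 \<in> {a 1 + a 2 <..< a 1 + a 2 + a 3} \<and>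
          2 * a 1 + \<alpha> 2 \<ge> 1 \<and>
          2 * a 1 * (1 - \<alpha> 3) + 2 * a 2 * (\<alpha> 2 - \<alpha> 3) \<ge> (1 - \<alpha> 3)^2))"
proof -
  define z2 where "z2 = \<alpha> 2 * x + (1 - \<alpha> 2) * y"
  define z3 where "z3 = \<alpha> 3 * x + (1 - \<alpha> 3) * y"
  have d: "y - x > 0" using assms(1) by simp
  have gaps: "z2 - x = (1 - \<alpha> 2) * (y - x)" "z3 - z2 = (\<alpha> 2 - \<alpha> 3) * (y - x)"
    "y - z3 = \<alpha> 3 * (y - x)"
    by (simp_all add: z2_def z3_def algebra_simps)
  have "0 < z2 - x" "0 < z3 - z2" "0 < y - z3"
    unfolding gaps using assms(5-9) d by simp_all
  then have z: "x < z2" "z2 < z3" "z3 < y" by simp_all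
  have sum4: "(\<Sum>i=1..4. g i) = g 1 + g 2 + g 3 + g 4" for g :: "nat \<Rightarrow> real"
    by (simp add: numeral_eq_Suc)
  have mean: "a 1 * x + a 2 * z2 + a 3 * z3 + a 4 * y = (x + y) / 2 \<longleftrightarrow>
      (\<Sum>i=1..4. a i * (1 - \<alpha> i)) = 1 / 2"
  proof -
    have "a 1 * x + a 2 * z2 + a 3 * z3 + a 4 * y - (x + y) / 2
        = (y - x) * ((\<Sum>i=1..4. a i * (1 - \<alpha> i)) - 1 / 2)"
      using assms(4) unfolding sum4 assms(5)[symmetric] assms(9) z2_def z3_def
      by (simp add: field_simps) algebra
    then have "a 1 * x + a 2 * z2 + a 3 * z3 + a 4 * y - (x + y) / 2 = 0
        \<longleftrightarrow> (\<Sum>i=1..4. a i * (1 - \<alpha> i)) - 1 / 2 = 0"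
      using d by (simp only: mult_eq_0_iff) simp
    then show ?thesis by (simp only: right_minus_eq)
  qed
  have ends: "z2 - x \<le> 2 * a 1 * (y - x) \<longleftrightarrow> 2 * a 1 + \<alpha> 2 \<ge> 1"
    "y - z3 \<le> 2 * a 4 * (y - x) \<longleftrightarrow> \<alpha> 3 \<le> 2 * a 4"
    unfolding gaps using d by auto
  have "(\<forall>f. convex_on {x..y} f \<longrightarrow>
            (\<Sum>i=1..4. a i * f (\<alpha> i * x + (1 - \<alpha> i) * y)) \<ge> 1 / (y - x) * integral {x..y} f)
    \<longleftrightarrow> (\<forall>f. convex_on {x..y} f \<longrightarrow>
          integral {x..y} f \<le> (y - x) * (a 1 * f x + a 2 * f z2 + a 3 * f z3 + a 4 * f y))"
    unfolding sum4 assms(5)[symmetric] assms(9) z2_def z3_def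
    using d by (simp add: pos_divide_le_eq mult.commute)
  also have "\<dots> \<longleftrightarrow> (\<Sum>i=1..4. a i * (1 - \<alpha> i)) = 1 / 2 \<and> 2 * a 1 + \<alpha> 2 \<ge> 1 \<and> \<alpha> 3 \<le> 2 * a 4"
    unfolding four_point_ge_integral_iff[OF z] mean ends using assms(4) by simp
  finally have bounds: "(\<forall>f. convex_on {x..y} f \<longrightarrow>
            (\<Sum>i=1..4. a i * f (\<alpha> i * x + (1 - \<alpha> i) * y)) \<ge> 1 / (y - x) * integral {x..y} f)
    \<longleftrightarrow> (\<Sum>i=1..4. a i * (1 - \<alpha> i)) = 1 / 2 \<and> 2 * a 1 + \<alpha> 2 \<ge> 1 \<and> \<alpha> 3 \<le> 2 * a 4" .
  have pos: "a 1 > 0" "a 4 > 0" using assms(2) by simp_all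
  show ?thesis
  proof (rule trans[OF bounds], rule conj_cong[OF refl], rule end_weight_bounds_iff_cases)
    assume "(\<Sum>i=1..4. a i * (1 - \<alpha> i)) = 1 / 2"
    then show "a 2 * (1 - \<alpha> 2) + a 3 * (1 - \<alpha> 3) + a 4 = 1 / 2"
      unfolding sum4 assms(5)[symmetric] assms(9) by simp
  qed (use assms(4-9) pos in simp_all)
qed

end
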